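(* If $G$ is a disconnected cograph without isolated vertices having $k$ connected components, then $\chi_{td}(G)=\chi(G)+2(k-1)$.
   Context: All graphs are finite, simple and undirected. A cograph is a graph with no induced path on four vertices. $\chi(G)$ is the chromatic number. A total dominator coloring (TD-coloring) of an isolate-free graph $G$ is a proper vertex coloring such that every vertex is adjacent to all vertices of some color class; $\chi_{td}(G)$ is the minimum number of colors in a TD-coloring. *)

theory Defs
  imports "Graph_Theory.Graph_Theory"
begin

text \<open>
  Finite simple undirected graphs are the locale \<open>graph\<close>: each edge \<open>uv\<close> is the pair of arcs
  \<open>u \<rightarrow> v\<close>, \<open>v \<rightarrow> u\<close>. Adjacency is therefore \<open>u \<rightarrow>\<^bsub>G\<^esub> v\<close>.
\<close>

definition cograph :: "('a, 'b) pre_digraph \<Rightarrow> bool" where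
  "cograph G \<longleftrightarrow> graph G \<and>
    \<not> (\<exists>a\<in>verts G. \<exists>b\<in>verts G. \<exists>c\<in>verts G. \<exists>d\<in>verts G.
        distinct [a, b, c, d] \<and>
        a \<rightarrow>\<^bsub>G\<^esub> b \<and> b \<rightarrow>\<^bsub>G\<^esub> c \<and> c \<rightarrow>\<^bsub>G\<^esub> d \<and>
        \<not> a \<rightarrow>\<^bsub>G\<^esub> c \<and> \<not> a \<rightarrow>\<^bsub>G\<^esub> d \<and> \<not> b \<rightarrow>\<^bsub>G\<^esub> d)"

definition isolated_vertex :: "('a, 'b) pre_digraph \<Rightarrow> 'a \<Rightarrow> bool" where
  "isolated_vertex G v \<longleftrightarrow> v \<in> verts G \<and> \<not> (\<exists>u\<in>verts G. v \<rightarrow>\<^bsub>G\<^esub> u)"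

definition connected_components :: "('a, 'b) pre_digraph \<Rightarrow> ('a, 'b) pre_digraph set" where
  "connected_components G = {H. pre_digraph.max_subgraph G Digraph_Component.connected H}"

definition proper_coloring :: "('a, 'b) pre_digraph \<Rightarrow> ('a \<Rightarrow> nat) \<Rightarrow> bool" where
  "proper_coloring G f \<longleftrightarrow> (\<forall>u\<in>verts G. \<forall>v\<in>verts G. u \<rightarrow>\<^bsub>G\<^esub> v \<longrightarrow> f u \<noteq> f v)"

text \<open>Only colors that are actually used give color classes, so every class is nonempty.\<close>

definition color_classes :: "('a, 'b) pre_digraph \<Rightarrow> ('a \<Rightarrow> nat) \<Rightarrow> 'a set set" where
  "color_classes G f = (\<lambda>c. {v \<in> verts G. f v = c}) ` f ` verts G"

definition chromatic_number :: "('a, 'b) pre_digraph \<Rightarrow> nat" where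
  "chromatic_number G = (LEAST n. \<exists>f. proper_coloring G f \<and> card (f ` verts G) = n)"

definition td_coloring :: "('a, 'b) pre_digraph \<Rightarrow> ('a \<Rightarrow> nat) \<Rightarrow> bool" where
  "td_coloring G f \<longleftrightarrow> proper_coloring G f \<and>
    (\<forall>v\<in>verts G. \<exists>C\<in>color_classes G f. \<forall>u\<in>C. v \<rightarrow>\<^bsub>G\<^esub> u)"

definition td_chromatic_number :: "('a, 'b) pre_digraph \<Rightarrow> nat" where
  "td_chromatic_number G = (LEAST n. \<exists>f. td_coloring G f \<and> card (f ` verts G) = n)"

end

theory Submission
  imports Defs
begin

text \<open>
  Every vertex dominates a color class, and this class lies in the component of the vertex. Applying
  this to a vertex and then to a member of the class it dominates gives two colors private to each
  component. So each component avoids at least \<open>2(k-1)\<close> colors, and since components can be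
  recolored independently, \<open>\<chi> \<le> \<chi>\<^sub>t\<^sub>d - 2(k-1)\<close>.

  Conversely, each component has at least two vertices and is connected and \<open>P\<^sub>4\<close>-free, hence
  its complement is disconnected, so it is a join of two nonempty parts. Given any proper coloring, pick a color in each part; every vertex of the component
  is adjacent to all vertices of the component having one of these two colors. Making these two
  colors private in every component, and sharing the remaining \<open>\<chi> - 2\<close> ones, uses
  \<open>2k + \<chi> - 2\<close> colors.
\<close>

section \<open>Joins in \<open>P\<^sub>4\<close>-free relations\<close>

text \<open>Phrased for a relation on a vertex set, not for a digraph, so that restricting to a
  subset and complementing adjacency stay within the same notion.\<close>

definition P4_free :: "('a \<Rightarrow> 'a \<Rightarrow> bool) \<Rightarrow> 'a set \<Rightarrow> bool" where
  "P4_free R V \<longleftrightarrow> (\<forall>a\<in>V. \<forall>b\<in>V. \<forall>c\<in>V. \<forall>d\<in>V. distinct [a, b, c, d] \<longrightarrow>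
     R a b \<longrightarrow> R b c \<longrightarrow> R c d \<longrightarrow> R a c \<or> R a d \<or> R b d)"

text \<open>For symmetric \<open>R\<close> this is disconnectedness of the graph on
  \<open>V\<close>. Applied to the negation of \<open>R\<close> it says that \<open>V\<close> is a
  join of two nonempty parts.\<close>

definition separable :: "('a \<Rightarrow> 'a \<Rightarrow> bool) \<Rightarrow> 'a set \<Rightarrow> bool" where
  "separable R V \<longleftrightarrow> (\<exists>A B. A \<noteq> {} \<and> B \<noteq> {} \<and> A \<union> B = V \<and> A \<inter> B = {} \<and> (\<forall>a\<in>A. \<forall>b\<in>B. \<not> R a b))"

lemma separableI:
  assumes "A \<noteq> {}" "B \<noteq> {}" "A \<union> B = V" "A \<inter> B = {}" "\<And>a b. a \<in> A \<Longrightarrow> b \<in> B \<Longrightarrow> \<not> R a b"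
  shows "separable R V"
  unfolding separable_def using assms by (intro exI[of _ A] exI[of _ B] conjI ballI) auto

lemma P4_freeD:
  assumes "P4_free R V" "a \<in> V" "b \<in> V" "c \<in> V" "d \<in> V" "distinct [a, b, c, d]"
    "R a b" "R b c" "R c d"
  shows "R a c \<or> R a d \<or> R b d"
  using assms(1)[unfolded P4_free_def, rule_format, OF assms(2-)] .

lemma P4_free_mono:
  assumes "P4_free R V" "W \<subseteq> V"
  shows "P4_free R W"
  unfolding P4_free_def
proof (intro ballI impI)
  fix a b c d
  assume "a \<in> W" "b \<in> W" "c \<in> W" "d \<in> W" "distinct [a, b, c, d]" "R a b" "R b c" "R c d"
  with assms(2) show "R a c \<or> R a d \<or> R b d" by (intro P4_freeD[OF assms(1)]) auto
qed

text \<open>P4 is self-complementary: an induced path \<open>a b c d\<close> of the complement is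
  the induced path \<open>b d a c\<close> of \<open>R\<close>.\<close>

lemma P4_free_complement:
  assumes "symp R" "P4_free R V"
  shows "P4_free (\<lambda>x y. \<not> R x y) V"
  unfolding P4_free_def
proof (intro ballI impI, rule ccontr)
  fix a b c d
  assume V: "a \<in> V" "b \<in> V" "c \<in> V" "d \<in> V" and "distinct [a, b, c, d]"
    and R: "\<not> R a b" "\<not> R b c" "\<not> R c d" "\<not> (\<not> R a c \<or> \<not> R a d \<or> \<not> R b d)"
  then have "distinct [b, d, a, c]" "R b d" "R d a" "R a c"
    using sympD[OF assms(1)] by auto
  then have "R b a \<or> R b c \<or> R d c" using P4_freeD[OF assms(2) V(2,4,1,3)] by blast
  then show False using R sympD[OF assms(1)] by blast
qed

text \<open>If \<open>v\<close> is adjacent to all of \<open>W\<close>, then \<open>{v}\<close> and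
  \<open>W\<close> form a join. Otherwise some side of the separation contains a non-neighbor of
  \<open>v\<close>; either the other side has no neighbor of \<open>v\<close> and splits off, or the
  non-neighbors of \<open>v\<close> on the first side do. \<open>part\<close> leaves the sides open
  so that it serves both.\<close>

lemma P4_free_insert_separable:
  assumes sym: "symp R" and free: "P4_free R (insert v W)" and v: "v \<notin> W" and sep: "separable R W"
  shows "separable R (insert v W) \<or> separable (\<lambda>x y. \<not> R x y) (insert v W)"
proof -
  have part: "separable R (insert v W)"
    if AB: "A \<noteq> {}" "B \<noteq> {}" "A \<union> B = W" "A \<inter> B = {}" "\<forall>a\<in>A. \<forall>b\<in>B. \<not> R a b"
      and x: "x \<in> A" "\<not> R v x" for A B x
  proof (cases "\<exists>z\<in>B. R v z")
    case False
    have "\<not> R a b" if "a \<in> B" "b \<in> insert v A" for a b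
      using that AB(5) False sympD[OF sym] by blast
    then show ?thesis
      by (intro separableI[where A=B and B="insert v A"]) (use AB v in auto)
  next
    case True
    then obtain z where z: "z \<in> B" "R v z" by blast
    \<comment> \<open>An edge \<open>a b\<close> leaving the non-neighbors of \<open>v\<close> in \<open>A\<close> would give the induced path \<open>z v b a\<close>.\<close>
    define N where "N = {y \<in> A. \<not> R v y}"
    have "\<not> R a b" if "a \<in> N" "b \<in> insert v W - N" for a b
    proof
      assume "R a b"
      then have "b \<noteq> v" "b \<notin> B" using that AB sympD[OF sym] unfolding N_def by auto
      then have b: "b \<in> A" "R v b" using that AB unfolding N_def by auto
      have a: "a \<in> A" "\<not> R v a" using that unfolding N_def by auto
      have "distinct [z, v, b, a]" using z a b AB v by auto
      moreover have "R z v" "R b a" "\<not> R z b" "\<not> R z a"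
        using z a b AB \<open>R a b\<close> sympD[OF sym] by blast+
      ultimately show False
        using P4_freeD[OF free, of z v b a] z a b AB by blast
    qed
    then show ?thesis
      by (intro separableI[where A=N and B="insert v W - N"])
        (use AB x v in \<open>auto simp: N_def\<close>)
  qed
  from sep obtain A B where AB: "A \<noteq> {}" "B \<noteq> {}" "A \<union> B = W" "A \<inter> B = {}"
    "\<forall>a\<in>A. \<forall>b\<in>B. \<not> R a b"
    unfolding separable_def by blast
  show ?thesis
  proof (cases "\<exists>x\<in>W. \<not> R v x")
    case True
    then obtain x where "x \<in> W" "\<not> R v x" by blast
    then show ?thesis
      using part[of A B x] part[of B A x] AB sympD[OF sym] by blast
  next
    case False
    then have "separable (\<lambda>x y. \<not> R x y) (insert v W)"
      using AB v by (intro separableI[where A="{v}" and B=W]) auto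
    then show ?thesis ..
  qed
qed

text \<open>Induction on the vertex set, starting from two vertices. The hypotheses are invariant
  under complementation, so the insertion lemma handles either alternative for \<open>W\<close>,
  applied to \<open>R\<close> or to its negation; in the latter case a double negation
  cancels.\<close>

lemma P4_free_separable_or_complement:
  assumes "finite V" "symp R" "P4_free R V" "card V \<ge> 2"
  shows "separable R V \<or> separable (\<lambda>x y. \<not> R x y) V"
  using assms(1,3,4)
proof (induction V rule: finite_induct)
  case empty
  then show ?case by simp
next
  case (insert v W)
  have symc: "symp (\<lambda>x y. \<not> R x y)" using assms(2) by (auto simp: symp_def)
  show ?case
  proof (cases "card W \<ge> 2")
    case True
    then have "separable R W \<or> separable (\<lambda>x y. \<not> R x y) W"
      using insert P4_free_mono by blast
    then show ?thesis
      using P4_free_insert_separable[OF assms(2) insert.prems(1) insert.hyps(2)]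
        P4_free_insert_separable[OF symc P4_free_complement[OF assms(2) insert.prems(1)]
          insert.hyps(2)]
      by auto
  next
    case False
    with insert have "card W = 1" by simp
    then obtain w where w: "W = {w}" by (auto simp: card_1_singleton_iff)
    show ?thesis
    proof (cases "R v w")
      case True
      then have "separable (\<lambda>x y. \<not> R x y) (insert v W)"
        using w insert by (intro separableI[where A="{v}" and B="{w}"]) auto
      then show ?thesis ..
    next
      case False
      then have "separable R (insert v W)"
        using w insert by (intro separableI[where A="{v}" and B="{w}"]) auto
      then show ?thesis ..
    qed
  qed
qed

section \<open>Connected components\<close>

lemma (in wf_digraph) strongly_connected_imp_connected:
  "strongly_connected G \<Longrightarrow> Digraph_Component.connected G"
  by (auto simp: strongly_connected_def intro!: connectedI reachable_mk_symmetricI)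

lemma arc_mono_connected: "arc_mono Digraph_Component.connected"
  unfolding arc_mono_def
  by (metis spanning_def subgraph_def wf_digraph.connected_spanning_imp_connected)

text \<open>Connectedness and strong connectedness agree on symmetric digraphs, but a subgraph of
  \<open>G\<close> may contain an arc without its reverse. A maximal connected subgraph is induced,
  since adding arcs preserves connectedness, and is therefore symmetric.\<close>

lemma (in sym_digraph) connected_components_eq_sccs: "connected_components G = sccs"
proof (intro equalityI subsetI)
  fix H assume "H \<in> connected_components G"
  then have max: "max_subgraph Digraph_Component.connected H"
    by (simp add: connected_components_def)
  then have "induced_subgraph H G"
    using arc_mono_connected by (rule induced_subgraphI_arc_mono)
  then interpret H: sym_digraph H by (rule induced_graph_imp_graph)
  have sc: "strongly_connected H"
    using H.symmetric_connected_imp_strongly_connected H.sym_arcs max_subgraph_prop[OF max] by blast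
  have "\<not> strongly_connected H'" if "H \<noteq> H'" "subgraph H H'" "subgraph H' G" for H'
    using that max wf_digraph.strongly_connected_imp_connected[of H']
    unfolding max_subgraph_def subgraph_def by metis
  with sc max have "max_subgraph strongly_connected H"
    by (intro max_subgraphI) (auto simp: max_subgraph_def)
  then show "H \<in> sccs" by (simp add: sccs_altdef2)
next
  fix H assume "H \<in> sccs"
  then have max: "max_subgraph strongly_connected H" by (simp add: sccs_altdef2)
  then have "subgraph H G" by (rule subgraphI_max_subgraph)
  then interpret H: wf_digraph H by (simp add: subgraph_def)
  have "\<not> Digraph_Component.connected K"
    if "H \<noteq> K" and HK: "subgraph H K" and KG: "subgraph K G" for K
  proof
    assume con: "Digraph_Component.connected K"
    \<comment> \<open>\<open>K\<close> itself may fail to be symmetric. The subgraph induced on its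
      vertices is symmetric and still connected, hence strongly connected, so maximality of
      \<open>H\<close> applies to it and squeezes \<open>K\<close> between two equal graphs.\<close>
    let ?K = "G \<restriction> verts K"
    have sub: "subgraph K ?K" using KG by (rule subgraph_induce_subgraphI2)
    have ind: "induced_subgraph ?K G"
      using KG by (auto intro: induced_induce simp: subgraph_def)
    then interpret K: sym_digraph ?K by (rule induced_graph_imp_graph)
    have "Digraph_Component.connected ?K"
      using arc_mono_connected con sub unfolding arc_mono_def by (metis induce_subgraph_verts)
    then have "strongly_connected ?K"
      using K.symmetric_connected_imp_strongly_connected K.sym_arcs by blast
    moreover have "subgraph H ?K" using HK sub by (rule subgraph_trans)
    ultimately have "H = ?K"
      using max induced_imp_subgraph[OF ind] unfolding max_subgraph_def by metis
    with sub HK have "H = K"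
      by (auto simp: subgraph_def compatible_def)
    with \<open>H \<noteq> K\<close> show False ..
  qed
  with max have "max_subgraph Digraph_Component.connected H"
    using H.strongly_connected_imp_connected \<open>subgraph H G\<close> max_subgraph_prop
    by (intro max_subgraphI) blast+
  then show "H \<in> connected_components G" by (simp add: connected_components_def)
qed

context sym_digraph
begin

lemma card_connected_components: "card (connected_components G) = card sccs_verts"
  by (simp add: connected_components_eq_sccs card_sccs_verts)

lemma sccs_verts_eq_scc_of: "C \<in> sccs_verts \<Longrightarrow> v \<in> C \<Longrightarrow> C = scc_of v"
  using sccs_verts_disjoint scc_of_in_sccs_verts in_scc_of_self sccs_verts_subsets by blast

lemma adj_in_scc:
  assumes "C \<in> sccs_verts" "u \<in> C" "u \<rightarrow>\<^bsub>G\<^esub> v"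
  shows "v \<in> C"
  using assms sccs_verts_eq_scc_of scc_ofI_reachable' by blast

text \<open>A path starting in \<open>A\<close> stays in the component and has no edge on which to
  enter \<open>B\<close>. This excludes one alternative of the P4-free dichotomy, so a component
  with at least two vertices is a join.\<close>

lemma scc_not_separable:
  assumes "C \<in> sccs_verts"
  shows "\<not> separable (dominates G) C"
proof
  assume "separable (dominates G) C"
  then obtain A B where AB: "A \<noteq> {}" "B \<noteq> {}" "A \<union> B = C" "A \<inter> B = {}"
    "\<forall>a\<in>A. \<forall>b\<in>B. \<not> a \<rightarrow>\<^bsub>G\<^esub> b"
    unfolding separable_def by blast
  then obtain a b where ab: "a \<in> A" "b \<in> B" by blast
  then have "a \<rightarrow>\<^sup>*\<^bsub>G\<^esub> b" using assms AB by (auto simp: in_sccs_verts_conv_reachable)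
  then have "b \<in> A"
  proof (induction rule: reachable_induct)
    case base
    then show ?case using ab by simp
  next
    case (step x y)
    then show ?case using adj_in_scc[OF assms, of x y] AB by blast
  qed
  then show False using ab AB by blast
qed

end

section \<open>Colorings\<close>

text \<open>Used to rename the colors of a component so that its two dominating colors become 0 and
  1; the remaining elements are matched with \<open>{2..<card S}\<close>.\<close>

lemma finite_relabel_pair:
  fixes p q :: 'a
  assumes "finite S" "p \<in> S" "q \<in> S" "p \<noteq> q"
  obtains h :: "'a \<Rightarrow> nat" where "inj_on h S" "h ` S \<subseteq> {..<card S}" "h p = 0" "h q = 1"
proof -
  have "card {p, q} \<le> card S" using assms by (intro card_mono) auto
  then have "card S \<ge> 2" using assms by simp
  have "card (S - {p, q}) = card {2..<card S}"
    using assms by (subst card_Diff_subset) auto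
  then obtain g where g: "bij_betw g (S - {p, q}) {2..<card S}"
    using assms finite_same_card_bij[of "S - {p, q}" "{2..<card S}"] by auto
  have g2: "2 \<le> g x" "g x < card S" if "x \<in> S" "x \<noteq> p" "x \<noteq> q" for x
    using bij_betwE[OF g] that by auto
  let ?h = "\<lambda>x. if x = p then 0 else if x = q then 1 else g x"
  have "inj_on ?h S"
  proof (rule inj_onI)
    fix x y assume "x \<in> S" "y \<in> S" "?h x = ?h y"
    then show "x = y"
      using g2[of x] g2[of y] inj_onD[OF bij_betw_imp_inj_on[OF g], of x y]
      by (auto split: if_splits)
  qed
  moreover have "?h ` S \<subseteq> {..<card S}" using g2 \<open>card S \<ge> 2\<close> by auto
  ultimately show thesis using that[of ?h] assms(4) by auto
qed

lemma (in graph) proper_coloring_exists: "\<exists>f. proper_coloring G f"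
proof -
  obtain f :: "'a \<Rightarrow> nat" where "inj_on f (verts G)"
    using finite_imp_inj_to_nat_seg[OF finite_verts] by blast
  then have "proper_coloring G f"
    using adj_not_same unfolding proper_coloring_def inj_on_def by blast
  then show ?thesis by blast
qed

lemma (in graph) chromatic_number_attained:
  obtains f where "proper_coloring G f" "card (f ` verts G) = chromatic_number G"
proof -
  have "\<exists>f. proper_coloring G f \<and> card (f ` verts G) = chromatic_number G"
    using LeastI_ex[of "\<lambda>n. \<exists>f. proper_coloring G f \<and> card (f ` verts G) = n"]
      proper_coloring_exists unfolding chromatic_number_def by auto
  with that show thesis by auto
qed

lemma chromatic_number_le: "proper_coloring G f \<Longrightarrow> chromatic_number G \<le> card (f ` verts G)"
  unfolding chromatic_number_def by (rule Least_le) auto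

lemma td_chromatic_number_le: "td_coloring G f \<Longrightarrow> td_chromatic_number G \<le> card (f ` verts G)"
  unfolding td_chromatic_number_def by (rule Least_le) auto

text \<open>The \<open>LEAST\<close> in \<open>td_chromatic_number\<close> is only known to be
  attained once some TD-coloring is at hand; \<open>g\<close> is that witness.\<close>

lemma td_chromatic_number_attained:
  assumes "td_coloring G g"
  obtains f where "td_coloring G f" "card (f ` verts G) = td_chromatic_number G"
proof -
  have "\<exists>f. td_coloring G f \<and> card (f ` verts G) = td_chromatic_number G"
    using LeastI_ex[of "\<lambda>n. \<exists>f. td_coloring G f \<and> card (f ` verts G) = n"]
      assms unfolding td_chromatic_number_def by auto
  with that show thesis by auto
qed

section \<open>Lower bound: colors private to a component\<close>

text \<open>The class of \<open>u\<close> lies in the neighborhood of \<open>v\<close>, and the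
  class of \<open>t\<close> in that of \<open>u\<close>, so neither leaves the component. The two
  colors differ because \<open>u\<close> and \<open>t\<close> are adjacent.\<close>

lemma (in sym_digraph) td_coloring_private_colors:
  assumes td: "td_coloring G f" and C: "C \<in> sccs_verts"
  shows "\<exists>P\<subseteq>f ` verts G. card P = 2 \<and> (\<forall>v\<in>verts G. f v \<in> P \<longrightarrow> v \<in> C)"
proof -
  \<comment> \<open>Color classes are nonempty, so a dominated class can be represented by one of
    its members \<open>u\<close>, which is then itself a neighbor of \<open>v\<close>.\<close>
  have dom: "\<exists>u\<in>verts G. v \<rightarrow>\<^bsub>G\<^esub> u \<and> (\<forall>w\<in>verts G. f w = f u \<longrightarrow> v \<rightarrow>\<^bsub>G\<^esub> w)" if "v \<in> verts G" for v
    using td that unfolding td_coloring_def color_classes_def by fastforce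
  obtain v where v: "v \<in> C" "v \<in> verts G"
    using C sccs_verts_subsets by (auto simp: in_sccs_verts_conv_reachable)
  obtain u where u: "u \<in> verts G" "v \<rightarrow>\<^bsub>G\<^esub> u" "\<And>w. w \<in> verts G \<Longrightarrow> f w = f u \<Longrightarrow> v \<rightarrow>\<^bsub>G\<^esub> w"
    using dom[OF v(2)] by blast
  obtain t where t: "t \<in> verts G" "u \<rightarrow>\<^bsub>G\<^esub> t" "\<And>w. w \<in> verts G \<Longrightarrow> f w = f t \<Longrightarrow> u \<rightarrow>\<^bsub>G\<^esub> w"
    using dom[OF u(1)] by blast
  have "u \<in> C" using adj_in_scc[OF C v(1) u(2)] .
  have "f u \<noteq> f t"
    using td u t unfolding td_coloring_def proper_coloring_def by blast
  moreover have "w \<in> C" if "w \<in> verts G" "f w \<in> {f u, f t}" for w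
    using that adj_in_scc[OF C v(1)] adj_in_scc[OF C \<open>u \<in> C\<close>] u t by blast
  ultimately show ?thesis using u t by (intro exI[of _ "{f u, f t}"]) auto
qed

text \<open>No edge joins two components, so each may be recolored by its own map into
  \<open>{..<n}\<close>; injectivity on the colors used there keeps the coloring proper.\<close>

lemma (in graph) chromatic_number_le_componentwise:
  assumes "\<And>C. C \<in> sccs_verts \<Longrightarrow> card (f ` C) \<le> n" and f: "proper_coloring G f"
  shows "chromatic_number G \<le> n"
proof -
  have "\<exists>h. inj_on h (f ` C) \<and> h ` f ` C \<subseteq> {..<n}" if "C \<in> sccs_verts" for C
  proof -
    have "finite (f ` C)"
      using that sccs_verts_subsets finite_verts finite_subset by blast
    then show ?thesis
      using card_le_inj[of "f ` C" "{..<n}"] assms(1)[OF that] by auto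
  qed
  then obtain h where h: "\<And>C. C \<in> sccs_verts \<Longrightarrow> inj_on (h C) (f ` C) \<and> h C ` f ` C \<subseteq> {..<n}"
    by metis
  define F where "F v = h (scc_of v) (f v)" for v
  have "proper_coloring G F"
    unfolding proper_coloring_def
  proof (intro ballI impI)
    fix u v assume uv: "u \<in> verts G" "v \<in> verts G" "u \<rightarrow>\<^bsub>G\<^esub> v"
    let ?C = "scc_of u"
    have C: "?C \<in> sccs_verts" "u \<in> ?C"
      using uv scc_of_in_sccs_verts in_scc_of_self by auto
    moreover have "v \<in> ?C" using adj_in_scc C uv by blast
    moreover have "scc_of v = ?C" using sccs_verts_eq_scc_of[OF C(1) \<open>v \<in> ?C\<close>] by simp
    moreover have "f u \<noteq> f v" using f uv unfolding proper_coloring_def by blast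
    ultimately show "F u \<noteq> F v"
      using h[OF C(1)] unfolding F_def by (auto dest: inj_onD)
  qed
  then have "chromatic_number G \<le> card (F ` verts G)" by (rule chromatic_number_le)
  also have "\<dots> \<le> card {..<n}"
    using h scc_of_in_sccs_verts in_scc_of_self unfolding F_def by (intro card_mono) blast+
  finally show ?thesis by simp
qed

lemma (in graph) td_coloring_lower_bound:
  assumes td: "td_coloring G f"
  shows "chromatic_number G + 2 * (card sccs_verts - 1) \<le> card (f ` verts G)"
proof (cases "verts G = {}")
  case True
  then have "sccs_verts = {}" by (simp add: sccs_verts_conv_scc_of)
  moreover have "proper_coloring G f" using td by (simp add: td_coloring_def)
  ultimately show ?thesis using chromatic_number_le by fastforce
next
  case False
  let ?k = "card sccs_verts"
  obtain P where P: "\<And>C. C \<in> sccs_verts \<Longrightarrow> P C \<subseteq> f ` verts G \<and> card (P C) = 2 \<and>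
      (\<forall>v\<in>verts G. f v \<in> P C \<longrightarrow> v \<in> C)"
    using td_coloring_private_colors[OF td] by metis
  have fin: "finite (P C)" if "C \<in> sccs_verts" for C
    using P[OF that] by (metis card.infinite zero_neq_numeral)
  have disj: "P C \<inter> P D = {}" if "C \<in> sccs_verts" "D \<in> sccs_verts" "C \<noteq> D" for C D
    using P[OF that(1)] P[OF that(2)] sccs_verts_disjoint[OF that] by blast
  have bound: "card (f ` C) + 2 * (?k - 1) \<le> card (f ` verts G)" if C: "C \<in> sccs_verts" for C
  proof -
    let ?Q = "\<Union>D\<in>sccs_verts - {C}. P D"
    have "card ?Q = (\<Sum>D\<in>sccs_verts - {C}. card (P D))"
      using fin disj finite_sccs_verts by (intro card_UN_disjoint) auto
    also have "\<dots> = 2 * (?k - 1)" using P C finite_sccs_verts by simp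
    finally have Q: "card ?Q = 2 * (?k - 1)" .
    have finQ: "finite ?Q" using fin finite_sccs_verts by blast
    have CG: "C \<subseteq> verts G" using sccs_verts_subsets[OF C] .
    have "f ` C \<inter> ?Q = {}"
    proof (rule ccontr)
      assume "f ` C \<inter> ?Q \<noteq> {}"
      then obtain v D where "v \<in> C" "D \<in> sccs_verts" "D \<noteq> C" "f v \<in> P D" by blast
      then show False using P[of D] CG sccs_verts_disjoint[OF C, of D] by blast
    qed
    then have "card (f ` C \<union> ?Q) = card (f ` C) + card ?Q"
      using finQ CG finite_verts finite_subset by (intro card_Un_disjoint) blast+
    moreover have "card (f ` C \<union> ?Q) \<le> card (f ` verts G)"
      using CG P finite_verts by (intro card_mono) blast+
    ultimately show ?thesis using Q by simp
  qed
  from False obtain C where "C \<in> sccs_verts" using sccs_verts_conv_scc_of by blast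
  \<comment> \<open>The existence of a component, hence the separate treatment of the empty graph,
    yields this inequality, which makes the truncated subtraction in the next bound a true
    one.\<close>
  then have "2 * (?k - 1) \<le> card (f ` verts G)" using bound by fastforce
  moreover have "chromatic_number G \<le> card (f ` verts G) - 2 * (?k - 1)"
    using bound td by (intro chromatic_number_le_componentwise[where f=f])
      (force simp: td_coloring_def)+
  ultimately show ?thesis by simp
qed

section \<open>Upper bound: a TD-coloring from a proper coloring\<close>

text \<open>The two sides of a join share no color. Hence inside \<open>C\<close> a color
  \<open>p\<close> taken from \<open>A\<close> occurs only in \<open>A\<close> and is dominated by
  all of \<open>B\<close>, and symmetrically for \<open>q\<close>. Both colors may still occur in
  other components, so these are not yet whole color classes.\<close>

lemma cograph_component_dominating_colors:
  assumes cog: "cograph G" and iso: "\<not> (\<exists>v. isolated_vertex G v)"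
    and f: "proper_coloring G f" and C: "C \<in> pre_digraph.sccs_verts G"
  shows "\<exists>p q. p \<in> f ` C \<and> q \<in> f ` C \<and> p \<noteq> q \<and>
    (\<forall>v\<in>C. (\<forall>u\<in>C. f u = p \<longrightarrow> v \<rightarrow>\<^bsub>G\<^esub> u) \<or> (\<forall>u\<in>C. f u = q \<longrightarrow> v \<rightarrow>\<^bsub>G\<^esub> u))"
proof -
  interpret graph G using cog by (simp add: cograph_def)
  have CG: "C \<subseteq> verts G" using sccs_verts_subsets[OF C] .
  then have fin: "finite C" using finite_verts finite_subset by blast
  obtain v where v: "v \<in> C" using C by (auto simp: in_sccs_verts_conv_reachable)
  then obtain w where "v \<rightarrow>\<^bsub>G\<^esub> w" using iso CG unfolding isolated_vertex_def by blast
  then have w: "w \<in> C" "w \<noteq> v" using adj_in_scc[OF C v] adj_not_same by auto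
  then have "card {v, w} \<le> card C" using v fin by (intro card_mono) auto
  then have "card C \<ge> 2" using w by simp
  moreover have sym: "symp (dominates G)" using graph_symmetric by (auto simp: symp_def)
  moreover have "P4_free (dominates G) (verts G)"
    unfolding P4_free_def
  proof (intro ballI impI, rule ccontr)
    fix a b c d
    assume "a \<in> verts G" "b \<in> verts G" "c \<in> verts G" "d \<in> verts G" "distinct [a, b, c, d]"
      "a \<rightarrow>\<^bsub>G\<^esub> b" "b \<rightarrow>\<^bsub>G\<^esub> c" "c \<rightarrow>\<^bsub>G\<^esub> d"
      "\<not> (a \<rightarrow>\<^bsub>G\<^esub> c \<or> a \<rightarrow>\<^bsub>G\<^esub> d \<or> b \<rightarrow>\<^bsub>G\<^esub> d)"
    then show False
      by - (rule notE[OF conjunct2[OF cog[unfolded cograph_def]]],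
          rule bexI[of _ a], rule bexI[of _ b], rule bexI[of _ c], rule bexI[of _ d], simp_all)
  qed
  ultimately have "separable (dominates G) C \<or> separable (\<lambda>x y. \<not> x \<rightarrow>\<^bsub>G\<^esub> y) C"
    using P4_free_separable_or_complement[OF fin] P4_free_mono CG by blast
  then have "separable (\<lambda>x y. \<not> x \<rightarrow>\<^bsub>G\<^esub> y) C" using scc_not_separable[OF C] by simp
  then obtain A B where AB: "A \<noteq> {}" "B \<noteq> {}" "A \<union> B = C" "A \<inter> B = {}"
    "\<forall>a\<in>A. \<forall>b\<in>B. a \<rightarrow>\<^bsub>G\<^esub> b"
    unfolding separable_def by auto
  obtain a b where ab: "a \<in> A" "b \<in> B" using AB by blast
  have neq: "f x \<noteq> f y" if "x \<in> A" "y \<in> B" for x y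
    using f AB that CG unfolding proper_coloring_def by blast
  have "v \<rightarrow>\<^bsub>G\<^esub> u" if "v \<in> B" "u \<in> C" "f u = f a" for u v
  proof -
    have "u \<in> A" using that AB(3) neq[OF ab(1), of u] by auto
    then show ?thesis using that AB(5) graph_symmetric by blast
  qed
  moreover have "v \<rightarrow>\<^bsub>G\<^esub> u" if "v \<in> A" "u \<in> C" "f u = f b" for u v
  proof -
    have "u \<in> B" using that AB(3) neq[OF _ ab(2), of u] by auto
    then show ?thesis using that AB(5) by blast
  qed
  ultimately show ?thesis
    using ab AB(3) neq[OF ab] by (intro exI[of _ "f a"] exI[of _ "f b"]) auto
qed

lemma cograph_td_coloring:
  assumes cog: "cograph G" and iso: "\<not> (\<exists>v. isolated_vertex G v)"
    and f: "proper_coloring G f" and ne: "verts G \<noteq> {}"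
  obtains F where "td_coloring G F"
    "card (F ` verts G) \<le> card (f ` verts G) + 2 * (card (pre_digraph.sccs_verts G) - 1)"
proof -
  interpret graph G using cog by (simp add: cograph_def)
  let ?n = "card (f ` verts G)" and ?k = "card sccs_verts"
  \<comment> \<open>Each component gets its own renaming of the colors, in which 0 and 1 are its
    dominating pair. Both must occur in \<open>C\<close>, since color classes are nonempty.\<close>
  have "\<exists>h :: nat \<Rightarrow> nat. inj_on h (f ` verts G) \<and> h ` f ` verts G \<subseteq> {..<?n} \<and>
      0 \<in> h ` f ` C \<and> 1 \<in> h ` f ` C \<and>
      (\<forall>v\<in>C. \<exists>c\<in>{0, 1}. \<forall>u\<in>C. h (f u) = c \<longrightarrow> v \<rightarrow>\<^bsub>G\<^esub> u)"
    if C: "C \<in> sccs_verts" for C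
  proof -
    have CG: "C \<subseteq> verts G" using sccs_verts_subsets[OF C] .
    obtain p q where pq: "p \<in> f ` C" "q \<in> f ` C" "p \<noteq> q"
      "\<And>v. v \<in> C \<Longrightarrow> (\<forall>u\<in>C. f u = p \<longrightarrow> v \<rightarrow>\<^bsub>G\<^esub> u) \<or> (\<forall>u\<in>C. f u = q \<longrightarrow> v \<rightarrow>\<^bsub>G\<^esub> u)"
      using cograph_component_dominating_colors[OF cog iso f C] by blast
    then have pqG: "p \<in> f ` verts G" "q \<in> f ` verts G" using CG by blast+
    obtain h :: "nat \<Rightarrow> nat" where h: "inj_on h (f ` verts G)" "h ` f ` verts G \<subseteq> {..<?n}"
      "h p = 0" "h q = 1"
      using finite_relabel_pair[OF _ pqG pq(3)] finite_verts by blast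
    have "f u = p" if "u \<in> C" "h (f u) = 0" for u
      using inj_onD[OF h(1), of "f u" p] that h CG pqG by auto
    moreover have "f u = q" if "u \<in> C" "h (f u) = 1" for u
      using inj_onD[OF h(1), of "f u" q] that h CG pqG by auto
    ultimately have "\<exists>c\<in>{0, 1}. \<forall>u\<in>C. h (f u) = c \<longrightarrow> v \<rightarrow>\<^bsub>G\<^esub> u" if "v \<in> C" for v
      using pq(4)[OF that] by blast
    moreover have "0 \<in> h ` f ` C" "1 \<in> h ` f ` C" using pq(1,2) h(3,4) by (metis imageI)+
    ultimately show ?thesis using h(1,2) by blast
  qed
  then obtain h :: "'a set \<Rightarrow> nat \<Rightarrow> nat" where
    h: "\<And>C. C \<in> sccs_verts \<Longrightarrow> inj_on (h C) (f ` verts G) \<and> h C ` f ` verts G \<subseteq> {..<?n} \<and>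
      0 \<in> h C ` f ` C \<and> 1 \<in> h C ` f ` C \<and>
      (\<forall>v\<in>C. \<exists>c\<in>{0, 1}. \<forall>u\<in>C. h C (f u) = c \<longrightarrow> v \<rightarrow>\<^bsub>G\<^esub> u)"
    by metis
  obtain i where "bij_betw i sccs_verts {0..<?k}"
    using ex_bij_betw_finite_nat[OF finite_sccs_verts] by blast
  then have i_inj: "inj_on i sccs_verts" and i_less: "\<And>C. C \<in> sccs_verts \<Longrightarrow> i C < ?k"
    by (auto simp: bij_betw_def)
  define g where "g v = h (scc_of v) (f v)" for v
  \<comment> \<open>The component with index \<open>i\<close> keeps 2i and 2i+1 for itself, so
    private colors fill the range below 2k. A shared color c \<ge> 2 is shifted to 2(k-1)+c, which
    is at least 2k.\<close>
  define F where "F v = (if g v < 2 then 2 * i (scc_of v) + g v else 2 * (?k - 1) + g v)" for v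
  have g: "g v < ?n" if "v \<in> verts G" for v
    using h[OF scc_of_in_sccs_verts[OF that]] that unfolding g_def by blast
  have g_eq: "g v = h C (f v)" if "C \<in> sccs_verts" "v \<in> C" for C v
    using sccs_verts_eq_scc_of[OF that] unfolding g_def by simp
  \<comment> \<open>Shared colors are too large to equal a private one; for private colors, the
    quotient and remainder modulo 2 recover the component and the old color.\<close>
  have priv: "u \<in> C \<and> g u = c"
    if "C \<in> sccs_verts" "u \<in> verts G" "c < 2" "F u = 2 * i C + c" for C u c
  proof -
    have u: "scc_of u \<in> sccs_verts" "u \<in> scc_of u"
      using that scc_of_in_sccs_verts in_scc_of_self by auto
    have "g u < 2" using that i_less[OF that(1)] unfolding F_def by (auto split: if_splits)
    then have "2 * i (scc_of u) + g u = 2 * i C + c" using that unfolding F_def by simp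
    then have "i (scc_of u) = i C" "g u = c" using \<open>g u < 2\<close> \<open>c < 2\<close> by presburger+
    then show ?thesis using inj_onD[OF i_inj _ u(1) that(1)] u by simp
  qed
  have "proper_coloring G F"
    unfolding proper_coloring_def
  proof (intro ballI impI)
    fix u v assume uv: "u \<in> verts G" "v \<in> verts G" "u \<rightarrow>\<^bsub>G\<^esub> v"
    let ?C = "scc_of u"
    have C: "?C \<in> sccs_verts" "u \<in> ?C"
      using uv scc_of_in_sccs_verts in_scc_of_self by auto
    have vC: "v \<in> ?C" using adj_in_scc C uv by blast
    have eq: "scc_of v = ?C" using sccs_verts_eq_scc_of[OF C(1) vC] by simp
    have "f u \<noteq> f v" using f uv unfolding proper_coloring_def by blast
    then have "g u \<noteq> g v"
      using h[OF C(1)] uv eq unfolding g_def by (auto dest: inj_onD)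
    then show "F u \<noteq> F v" using eq i_less[OF C(1)] unfolding F_def by auto
  qed
  moreover have "\<exists>K\<in>color_classes G F. \<forall>u\<in>K. v \<rightarrow>\<^bsub>G\<^esub> u" if v: "v \<in> verts G" for v
  proof -
    let ?C = "scc_of v"
    have C: "?C \<in> sccs_verts" "v \<in> ?C"
      using v scc_of_in_sccs_verts in_scc_of_self by auto
    obtain c where c: "c \<in> {0, 1}" "\<And>u. u \<in> ?C \<Longrightarrow> h ?C (f u) = c \<Longrightarrow> v \<rightarrow>\<^bsub>G\<^esub> u"
      using h[OF C(1)] C(2) by blast
    have "c \<in> h ?C ` f ` ?C" using h[OF C(1)] c(1) by auto
    then obtain w where w: "w \<in> ?C" "h ?C (f w) = c" by blast
    have wG: "w \<in> verts G" using w sccs_verts_subsets[OF C(1)] by blast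
    have "g w = c" using g_eq[OF C(1) w(1)] w by simp
    moreover have "scc_of w = ?C" using sccs_verts_eq_scc_of[OF C(1) w(1)] by simp
    ultimately have Fw: "F w = 2 * i ?C + c" using c(1) unfolding F_def by auto
    have "v \<rightarrow>\<^bsub>G\<^esub> u" if "u \<in> verts G" "F u = F w" for u
    proof -
      have "u \<in> ?C \<and> g u = c" using priv[OF C(1) that(1), of c] that(2) Fw c(1) by auto
      then show ?thesis using c(2)[of u] g_eq[OF C(1), of u] by metis
    qed
    then show ?thesis
      using wG by (intro bexI[of _ "{u \<in> verts G. F u = F w}"]) (auto simp: color_classes_def)
  qed
  ultimately have td: "td_coloring G F" unfolding td_coloring_def by blast
  obtain v where "v \<in> verts G" using ne by blast
  then have k: "?k > 0" using finite_sccs_verts scc_of_in_sccs_verts card_gt_0_iff by blast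
  \<comment> \<open>Private colors go up to 2(k-1)+1, which lies below
    \<open>?n + 2 * (?k - 1)\<close> only because at least two colors occur.\<close>
  have "?n \<ge> 2"
  proof -
    have C: "scc_of v \<in> sccs_verts" using scc_of_in_sccs_verts \<open>v \<in> verts G\<close> .
    then have "1 \<in> h (scc_of v) ` f ` verts G"
      using h[OF C] sccs_verts_subsets[OF C] by blast
    then have "1 \<in> {..<?n}" using h[OF C] by blast
    then show ?thesis by simp
  qed
  have "F w < ?n + 2 * (?k - 1)" if "w \<in> verts G" for w
  proof -
    have "i (scc_of w) < ?k" using i_less scc_of_in_sccs_verts that by blast
    then have "i (scc_of w) \<le> ?k - 1" by simp
    then show ?thesis using g[OF that] \<open>?n \<ge> 2\<close> unfolding F_def by auto
  qed
  then have "card (F ` verts G) \<le> card {..<?n + 2 * (?k - 1)}"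
    by (intro card_mono) auto
  then show thesis using that[OF td] by simp
qed

theorem theorem6:
  fixes G :: "('a, 'b) pre_digraph" and k :: nat
  assumes "cograph G"
    and "verts G \<noteq> {}"
    and "\<not> Digraph_Component.connected G"
    and "\<not> (\<exists>v. isolated_vertex G v)"
    and "k = card (connected_components G)"
  shows "td_chromatic_number G = chromatic_number G + 2 * (k - 1)"
proof -
  interpret graph G using assms(1) by (simp add: cograph_def)
  have k: "k = card sccs_verts" using assms(5) card_connected_components by simp
  obtain f where f: "proper_coloring G f" "card (f ` verts G) = chromatic_number G"
    by (rule chromatic_number_attained)
  obtain F where F: "td_coloring G F"
    "card (F ` verts G) \<le> card (f ` verts G) + 2 * (card sccs_verts - 1)"
    by (rule cograph_td_coloring[OF assms(1,4) f(1) assms(2)])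
  \<comment> \<open>\<open>F\<close> serves twice: it bounds the minimum from above, and it
    guarantees an optimal TD-coloring \<open>F'\<close> to which the lower bound applies.\<close>
  obtain F' where F': "td_coloring G F'" "card (F' ` verts G) = td_chromatic_number G"
    by (rule td_chromatic_number_attained[OF F(1)])
  show ?thesis
    using td_chromatic_number_le[OF F(1)] F(2) f(2) td_coloring_lower_bound[OF F'(1)] F'(2) k
    by simp
qed

end
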